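(* The following lower bounds hold for the maximum order $C(d,2)$ of a Cayley graph of degree $d$ and diameter two: $C(16,2)\geq 200$, $C(21,2)\geq 288$, $C(23,2)\geq 392$, $C(28,2)\geq 512$, $C(31,2)\geq 648$, $C(37,2)\geq 800$, $C(40,2)\geq 968$, $C(46,2)\geq 1152$, $C(49,2)\geq 1352$, $C(54,2)\geq 1568$.
   Context: For a finite group $\Gamma$ and a generating set $X$ of $\Gamma$ that is unit-free (does not contain the identity) and inverse-closed ($X=X^{-1}$), the Cayley graph $Cay(\Gamma,X)$ is the undirected simple graph with vertex set $\Gamma$ and edge set $\{\{g,h\} : g\in\Gamma,\ g^{-1}h\in X\}$. Its degree is $|X|$ and its order is its number of vertices $|\Gamma|$. The diameter of a graph is the maximum distance between two of its vertices. For a positive integer $d$, $C(d,2)$ denotes the maximum order of a Cayley graph of a finite group having degree $d$ and diameter two (orders of such graphs are bounded above by the Moore bound $d^2+1$). *)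

theory Defs
  imports
    "HOL-Algebra.Generated_Groups"
    "Graph_Theory.Graph_Theory"
begin

text \<open>
  An undirected simple graph is represented, as usual in the Graph_Theory development, by a
  loop-free digraph with a symmetric arc relation: each edge is a pair of opposite arcs.
\<close>

definition graph_dist :: "('a, 'b) pre_digraph \<Rightarrow> 'a \<Rightarrow> 'a \<Rightarrow> ereal" where
  "graph_dist G u v = wf_digraph.\<mu> G (\<lambda>_. 1) u v"

text \<open>
  On a finite nonempty graph the supremum is a maximum; it is \<open>\<infinity>\<close> if the graph is disconnected.
\<close>

definition graph_diameter :: "('a, 'b) pre_digraph \<Rightarrow> ereal" where
  "graph_diameter G = (SUP u\<in>verts G. SUP v\<in>verts G. graph_dist G u v)"

definition cayley_set :: "('a, 'm) monoid_scheme \<Rightarrow> 'a set \<Rightarrow> bool" where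
  "cayley_set \<Gamma> X \<longleftrightarrow>
     X \<subseteq> carrier \<Gamma> \<and> generate \<Gamma> X = carrier \<Gamma> \<and> \<one>\<^bsub>\<Gamma>\<^esub> \<notin> X \<and> set_inv\<^bsub>\<Gamma>\<^esub> X = X"

definition cayley_graph :: "('a, 'm) monoid_scheme \<Rightarrow> 'a set \<Rightarrow> 'a pair_pre_digraph" where
  "cayley_graph \<Gamma> X =
     \<lparr> pverts = carrier \<Gamma>,
       parcs = {(g, h). g \<in> carrier \<Gamma> \<and> h \<in> carrier \<Gamma> \<and> inv\<^bsub>\<Gamma>\<^esub> g \<otimes>\<^bsub>\<Gamma>\<^esub> h \<in> X} \<rparr>"

text \<open>
  The orders of the Cayley graphs of finite groups of degree \<open>d\<close> and diameter \<open>k\<close>. Taking the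
  group elements to be natural numbers loses no generality, see \<open>cayley_ordersI\<close> below.
\<close>

definition cayley_orders :: "nat \<Rightarrow> nat \<Rightarrow> nat set" where
  "cayley_orders d k =
     {order \<Gamma> | (\<Gamma> :: nat monoid) X.
        group \<Gamma> \<and> finite (carrier \<Gamma>) \<and> cayley_set \<Gamma> X \<and> card X = d \<and>
        graph_diameter (with_proj (cayley_graph \<Gamma> X)) = ereal (real k)}"

text \<open>
  The set below is finite by \<open>finite_cayley_orders\<close>; the maximum is unspecified when there is
  no Cayley graph with the given parameters.
\<close>

definition max_cayley_order :: "nat \<Rightarrow> nat \<Rightarrow> nat" where
  "max_cayley_order d k = Max (cayley_orders d k)"


lemma graph_dist_le_diameter:
  "u \<in> verts G \<Longrightarrow> v \<in> verts G \<Longrightarrow> graph_dist G u v \<le> graph_diameter G"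
  unfolding graph_diameter_def by (rule SUP_upper2[of u], assumption, rule SUP_upper)


section \<open>Cayley graphs are regular simple graphs\<close>

lemma cayley_graph_sel [simp]:
  "pverts (cayley_graph \<Gamma> X) = carrier \<Gamma>"
  "(g, h) \<in> parcs (cayley_graph \<Gamma> X) \<longleftrightarrow>
     g \<in> carrier \<Gamma> \<and> h \<in> carrier \<Gamma> \<and> inv\<^bsub>\<Gamma>\<^esub> g \<otimes>\<^bsub>\<Gamma>\<^esub> h \<in> X"
  by (auto simp: cayley_graph_def)

lemma wf_cayley_graph: "wf_digraph (with_proj (cayley_graph \<Gamma> X))"
  by unfold_locales (auto simp: cayley_graph_def)

lemma (in group) cayley_graph_pair_graph:
  assumes "finite (carrier G)" "cayley_set G X"
  shows "pair_graph (cayley_graph G X)"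
proof
  have "parcs (cayley_graph G X) \<subseteq> carrier G \<times> carrier G"
    by (auto simp: cayley_graph_def)
  then show "finite (parcs (cayley_graph G X))"
    using assms(1) finite_subset by blast
  show "finite (pverts (cayley_graph G X))"
    using assms(1) by simp
next
  fix e assume "e \<in> parcs (cayley_graph G X)"
  then show "fst e \<in> pverts (cayley_graph G X)" "snd e \<in> pverts (cayley_graph G X)"
    by (auto simp: cayley_graph_def)
  show "fst e \<noteq> snd e"
    using \<open>e \<in> _\<close> assms(2) by (auto simp: cayley_graph_def cayley_set_def)
next
  have "inv h \<otimes> g \<in> X"
    if "g \<in> carrier G" "h \<in> carrier G" "inv g \<otimes> h \<in> X" for g h
  proof -
    have "inv (inv g \<otimes> h) \<in> set_inv X"
      using that unfolding SET_INV_def by blast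
    then show ?thesis
      using that assms(2) by (simp add: cayley_set_def inv_mult_group)
  qed
  then show "symmetric (with_proj (cayley_graph G X))"
    by (auto simp: symmetric_def sym_def)
qed

lemma (in group) cayley_graph_out_degree:
  assumes "X \<subseteq> carrier G" "g \<in> carrier G"
  shows "out_degree (with_proj (cayley_graph G X)) g = card X"
proof -
  have "out_arcs (with_proj (cayley_graph G X)) g = (\<lambda>x. (g, g \<otimes> x)) ` X"
  proof (intro equalityI subsetI)
    fix e assume "e \<in> out_arcs (with_proj (cayley_graph G X)) g"
    then obtain h where h: "e = (g, h)" "h \<in> carrier G" "inv g \<otimes> h \<in> X"
      by (auto simp: out_arcs_def cayley_graph_def)
    have "h = g \<otimes> (inv g \<otimes> h)"
      using h assms by (simp add: m_assoc[symmetric])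
    then show "e \<in> (\<lambda>x. (g, g \<otimes> x)) ` X"
      using h by blast
  qed (use assms in \<open>auto simp: out_arcs_def m_assoc[symmetric] subset_iff\<close>)
  moreover have "inj_on (\<lambda>x. (g, g \<otimes> x)) X"
    using assms by (auto simp: inj_on_def subset_iff)
  ultimately show ?thesis
    by (simp add: out_degree_def card_image)
qed


section \<open>Independence of the carrier type\<close>

context
  fixes \<Gamma> :: "('a, 'm) monoid_scheme" and \<Delta> :: "('b, 'n) monoid_scheme"
    and X :: "'a set" and Y :: "'b set" and f :: "'a \<Rightarrow> 'b"
  assumes groups: "group \<Gamma>" "group \<Delta>"
    and hom: "f \<in> hom \<Gamma> \<Delta>" and sub: "X \<subseteq> carrier \<Gamma>" "f ` X \<subseteq> Y"
begin

interpretation A: wf_digraph "with_proj (cayley_graph \<Gamma> X)"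
  by (rule wf_cayley_graph)

interpretation B: wf_digraph "with_proj (cayley_graph \<Delta> Y)"
  by (rule wf_cayley_graph)

lemma cayley_awalk_hom:
  assumes "A.awalk u p v"
  shows "B.awalk (f u) (map (map_prod f f) p) (f v)"
  using assms
proof (induction p arbitrary: u)
  case Nil
  then show ?case
    using hom by (auto simp: A.awalk_Nil_iff B.awalk_Nil_iff hom_def)
next
  case (Cons e p)
  obtain g h where e: "e = (g, h)" by force
  interpret group_hom \<Gamma> \<Delta> f
    using groups hom by (simp add: group_hom_def group_hom_axioms_def)
  have gh: "g \<in> carrier \<Gamma>" "h \<in> carrier \<Gamma>" "inv\<^bsub>\<Gamma>\<^esub> g \<otimes>\<^bsub>\<Gamma>\<^esub> h \<in> X"
    using Cons.prems e by (auto simp: A.awalk_Cons_iff)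
  then have "f (inv\<^bsub>\<Gamma>\<^esub> g \<otimes>\<^bsub>\<Gamma>\<^esub> h) \<in> Y"
    using sub by blast
  then have "inv\<^bsub>\<Delta>\<^esub> (f g) \<otimes>\<^bsub>\<Delta>\<^esub> f h \<in> Y"
    using gh by simp
  then show ?case
    using Cons e gh by (auto simp: A.awalk_Cons_iff B.awalk_Cons_iff)
qed

lemma graph_dist_hom_le:
  "graph_dist (with_proj (cayley_graph \<Delta> Y)) (f u) (f v)
     \<le> graph_dist (with_proj (cayley_graph \<Gamma> X)) u v"
  unfolding graph_dist_def A.\<mu>_def
proof (rule INF_greatest)
  fix p assume "p \<in> {p. A.awalk u p v}"
  then have "B.awalk (f u) (map (map_prod f f) p) (f v)"
    by (simp add: cayley_awalk_hom)
  then have "B.\<mu> (\<lambda>_. 1) (f u) (f v) \<le> ereal (B.awalk_cost (\<lambda>_. 1) (map (map_prod f f) p))"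
    by (rule B.min_cost_le_walk_cost)
  then show "B.\<mu> (\<lambda>_. 1) (f u) (f v) \<le> ereal (A.awalk_cost (\<lambda>_. 1) p)"
    by (simp add: A.awalk_cost_def B.awalk_cost_def o_def)
qed

lemma graph_diameter_hom_le:
  assumes "f ` carrier \<Gamma> = carrier \<Delta>"
  shows "graph_diameter (with_proj (cayley_graph \<Delta> Y))
           \<le> graph_diameter (with_proj (cayley_graph \<Gamma> X))"
proof -
  have "graph_dist (with_proj (cayley_graph \<Delta> Y)) a b
          \<le> graph_diameter (with_proj (cayley_graph \<Gamma> X))"
    if "a \<in> carrier \<Delta>" "b \<in> carrier \<Delta>" for a b
  proof -
    obtain u v where "u \<in> carrier \<Gamma>" "v \<in> carrier \<Gamma>" "a = f u" "b = f v"
      using \<open>a \<in> carrier \<Delta>\<close> \<open>b \<in> carrier \<Delta>\<close> assms by blast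
    then show ?thesis
      using order_trans[OF graph_dist_hom_le[of u v]
          graph_dist_le_diameter[of u "with_proj (cayley_graph \<Gamma> X)" v]] by simp
  qed
  then show ?thesis
    unfolding graph_diameter_def[of "with_proj (cayley_graph \<Delta> Y)"]
    by (auto intro!: SUP_least)
qed

end

lemma cayley_ordersI:
  fixes \<Gamma> :: "('a, 'm) monoid_scheme"
  assumes "group \<Gamma>" and fin: "finite (carrier \<Gamma>)" and X: "cayley_set \<Gamma> X"
    and "card X = d"
    and dia: "graph_diameter (with_proj (cayley_graph \<Gamma> X)) = ereal (real k)"
  shows "order \<Gamma> \<in> cayley_orders d k"
proof -
  interpret group \<Gamma> by fact
  obtain f :: "'a \<Rightarrow> nat" where f: "inj_on f (carrier \<Gamma>)"
    using finite_imp_inj_to_nat_seg[OF fin] by blast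
  define g where "g = inv_into (carrier \<Gamma>) f"
  define \<Delta> :: "nat monoid" where
    "\<Delta> = \<lparr> carrier = f ` carrier \<Gamma>, monoid.mult = \<lambda>a b. f (g a \<otimes>\<^bsub>\<Gamma>\<^esub> g b), one = f \<one>\<^bsub>\<Gamma>\<^esub> \<rparr>"
  have gf [simp]: "g (f x) = x" if "x \<in> carrier \<Gamma>" for x
    using that f by (simp add: g_def)
  have \<Delta>: "carrier \<Delta> = f ` carrier \<Gamma>" "\<one>\<^bsub>\<Delta>\<^esub> = f \<one>\<^bsub>\<Gamma>\<^esub>"
    "x \<otimes>\<^bsub>\<Delta>\<^esub> y = f (g x \<otimes>\<^bsub>\<Gamma>\<^esub> g y)" for x y
    by (simp_all add: \<Delta>_def)
  have "group \<Delta>"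
  proof (rule groupI)
    fix x assume "x \<in> carrier \<Delta>"
    then obtain a where a: "a \<in> carrier \<Gamma>" "x = f a" by (auto simp: \<Delta>)
    then have "f (inv\<^bsub>\<Gamma>\<^esub> a) \<otimes>\<^bsub>\<Delta>\<^esub> x = \<one>\<^bsub>\<Delta>\<^esub>" "f (inv\<^bsub>\<Gamma>\<^esub> a) \<in> carrier \<Delta>"
      by (auto simp: \<Delta>)
    then show "\<exists>y\<in>carrier \<Delta>. y \<otimes>\<^bsub>\<Delta>\<^esub> x = \<one>\<^bsub>\<Delta>\<^esub>" by blast
  qed (auto simp: \<Delta> m_assoc)
  have hf: "f \<in> hom \<Gamma> \<Delta>" and hg: "g \<in> hom \<Delta> \<Gamma>"
    by (auto simp: hom_def \<Delta>)
  interpret F: group_hom \<Gamma> \<Delta> f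
    using \<open>group \<Gamma>\<close> \<open>group \<Delta>\<close> hf by (simp add: group_hom_def group_hom_axioms_def)
  have sub: "X \<subseteq> carrier \<Gamma>" "f ` X \<subseteq> carrier \<Delta>"
    using X by (auto simp: cayley_set_def \<Delta>(1))
  have gfX: "g ` f ` X = X"
    using sub(1) by (force simp: image_iff)
  have "cayley_set \<Delta> (f ` X)"
    unfolding cayley_set_def
  proof (intro conjI)
    show "generate \<Delta> (f ` X) = carrier \<Delta>"
      using F.generate_img[OF sub(1)] X by (simp add: cayley_set_def \<Delta>(1))
    show "\<one>\<^bsub>\<Delta>\<^esub> \<notin> f ` X"
    proof
      assume "\<one>\<^bsub>\<Delta>\<^esub> \<in> f ` X"
      then obtain x where "x \<in> X" "f x = f \<one>\<^bsub>\<Gamma>\<^esub>" by (metis \<Delta>(2) imageE)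
      then have "x = \<one>\<^bsub>\<Gamma>\<^esub>"
        using f sub(1) by (meson group.is_monoid group_axioms inj_onD monoid.one_closed subset_iff)
      with \<open>x \<in> X\<close> have "\<one>\<^bsub>\<Gamma>\<^esub> \<in> X" by simp
      then show False using X by (simp add: cayley_set_def)
    qed
    have "set_inv\<^bsub>\<Delta>\<^esub> (f ` X) = f ` (set_inv\<^bsub>\<Gamma>\<^esub> X)"
      using sub(1) by (auto simp: SET_INV_def subset_iff image_iff)
    then show "set_inv\<^bsub>\<Delta>\<^esub> (f ` X) = f ` X"
      using X by (simp add: cayley_set_def)
  qed (rule sub)
  moreover have "card (f ` X) = d"
    using f sub(1) \<open>card X = d\<close> by (metis card_image inj_on_subset)
  moreover have "order \<Delta> = order \<Gamma>"
    using f by (simp add: order_def \<Delta>(1) card_image)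
  moreover have "finite (carrier \<Delta>)"
    using fin by (simp add: \<Delta>)
  moreover have "graph_diameter (with_proj (cayley_graph \<Delta> (f ` X))) = ereal (real k)"
  proof (rule antisym)
    show "graph_diameter (with_proj (cayley_graph \<Delta> (f ` X))) \<le> ereal (real k)"
      using graph_diameter_hom_le[OF \<open>group \<Gamma>\<close> \<open>group \<Delta>\<close> hf sub(1) order.refl] dia
      by (simp add: \<Delta>)
    have "g ` carrier \<Delta> = carrier \<Gamma>"
      by (force simp: \<Delta>(1) image_iff)
    then show "ereal (real k) \<le> graph_diameter (with_proj (cayley_graph \<Delta> (f ` X)))"
      using graph_diameter_hom_le[OF \<open>group \<Delta>\<close> \<open>group \<Gamma>\<close> hg sub(2), of X] dia gfX by simp
  qed
  ultimately show ?thesis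
    unfolding cayley_orders_def mem_Collect_eq using \<open>group \<Delta>\<close>
    by (intro exI[of _ \<Delta>] exI[of _ "f ` X"]) (simp only: simp_thms)
qed


section \<open>The maximum is taken over a finite set\<close>

lemma (in group) cayley_awalk_word:
  assumes "pre_digraph.awalk (with_proj (cayley_graph G X)) u p v" "X \<subseteq> carrier G"
  shows "\<exists>xs. set xs \<subseteq> X \<and> length xs = length p \<and> foldr (\<otimes>) xs \<one> = inv u \<otimes> v"
  using assms
proof (induction p arbitrary: u)
  interpret wf_digraph "with_proj (cayley_graph G X)"
    by (rule wf_cayley_graph)
  {
    case Nil
    then show ?case by (auto simp: awalk_Nil_iff)
  next
    case (Cons e p)
    obtain g h where e: "e = (g, h)" by force
    have gh: "u = g" "g \<in> carrier G" "h \<in> carrier G" "inv g \<otimes> h \<in> X"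
      and w: "awalk h p v"
      using Cons.prems e by (auto simp: awalk_Cons_iff)
    obtain xs where xs: "set xs \<subseteq> X" "length xs = length p" "foldr (\<otimes>) xs \<one> = inv h \<otimes> v"
      using Cons.IH[OF w Cons.prems(2)] by blast
    have "v \<in> carrier G"
      using w by (auto dest: awalk_last_in_verts)
    then have "inv g \<otimes> h \<otimes> (inv h \<otimes> v) = inv g \<otimes> v"
      using gh by (metis inv_closed inv_solve_left m_assoc m_closed)
    then show ?case
      using xs gh by (intro exI[of _ "inv g \<otimes> h # xs"]) simp
  }
qed

lemma (in group) order_le_of_diameter:
  assumes fin: "finite (carrier G)" and X: "X \<subseteq> carrier G"
    and dia: "graph_diameter (with_proj (cayley_graph G X)) \<le> ereal (real k)"
  shows "order G \<le> (\<Sum>i\<le>k. card X ^ i)"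
proof -
  interpret wf_digraph "with_proj (cayley_graph G X)"
    by (rule wf_cayley_graph)
  define W where "W = {xs. set xs \<subseteq> X \<and> length xs \<le> k}"
  have "finite X"
    using X fin finite_subset by blast
  then have W: "finite W" "card W = (\<Sum>i\<le>k. card X ^ i)"
    unfolding W_def by (auto intro: finite_lists_length_le card_lists_length_le)
  have "carrier G \<subseteq> (\<lambda>xs. foldr (\<otimes>) xs \<one>) ` W"
  proof
    fix v assume v: "v \<in> carrier G"
    have "graph_dist (with_proj (cayley_graph G X)) \<one> v
            \<le> graph_diameter (with_proj (cayley_graph G X))"
      using v by (intro graph_dist_le_diameter) simp_all
    also note dia
    also have "ereal (real k) < ereal (real (Suc k))" by simp
    finally have "\<mu> (\<lambda>_. 1) \<one> v < ereal (real (Suc k))"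
      by (simp add: graph_dist_def)
    then obtain p where p: "awalk \<one> p v" "ereal (awalk_cost (\<lambda>_. 1) p) < ereal (real (Suc k))"
      unfolding \<mu>_def INF_less_iff by blast
    then have "length p \<le> k"
      by (simp add: awalk_cost_def sum_list_triv)
    with cayley_awalk_word[OF p(1) X] v show "v \<in> (\<lambda>xs. foldr (\<otimes>) xs \<one>) ` W"
      by (force simp: W_def)
  qed
  then have "card (carrier G) \<le> card W"
    using W(1) by (metis card_image_le card_mono finite_imageI order_trans)
  then show ?thesis
    by (simp add: order_def W(2))
qed

lemma finite_cayley_orders: "finite (cayley_orders d k)"
proof (rule finite_subset)
  show "cayley_orders d k \<subseteq> {.. \<Sum>i\<le>k. d ^ i}"
    unfolding cayley_orders_def cayley_set_def
    using group.order_le_of_diameter by fastforce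
qed simp

end

theory Submission
  imports Defs
begin

text \<open>
  The graphs have order \<open>2n\<^sup>2\<close> with \<open>n = 10, 12, \<dots>, 28\<close>; the group is the wreath product of \<open>\<int>\<^sub>n\<close> with
  \<open>\<int>\<^sub>2\<close>. A Cayley graph on \<open>X\<close>, not complete, has diameter two iff \<open>S = X \<union> {1}\<close> satisfies
  \<open>S S = G\<close>. Let \<open>P\<close> and \<open>Q\<close> be the subsets of \<open>\<int>\<^sub>n \<times> \<int>\<^sub>n\<close> that describe \<open>S\<close> inside and outside
  the base group. Since \<open>S\<close> is closed under inverses, all products can be written with differences,
  and \<open>S S = G\<close> becomes \<open>(P - P) \<union> (Q - Q) = \<int>\<^sub>n \<times> \<int>\<^sub>n = (Q - P) \<union> (Q - P\<^sup>T)\<close>, where \<open>P\<^sup>T\<close> is \<open>P\<close>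
  with swapped coordinates. The sets below were found by simulated annealing over the
  inverse-closed subsets; the two equations are checked row by row.
\<close>


section \<open>Cayley graphs of diameter two\<close>

text \<open>A walk of length \<open>m\<close> from \<open>\<one>\<close> spells \<open>g\<close> as
  a product of \<open>m\<close> elements of \<open>X\<close>; lengths 0 and 1 give only the identity
  and the elements of \<open>X\<close>.\<close>

lemma (in group) cayley_graph_dist_one_ge_two:
  assumes X: "X \<subseteq> carrier G" and g: "g \<in> carrier G" "g \<noteq> \<one>" "g \<notin> X"
  shows "2 \<le> graph_dist (with_proj (cayley_graph G X)) \<one> g"
proof -
  interpret wf_digraph "with_proj (cayley_graph G X)"
    by (rule wf_cayley_graph)
  have "2 \<le> length p" if p: "awalk \<one> p g" for p
  proof -
    obtain xs where xs: "set xs \<subseteq> X" "length xs = length p" "foldr (\<otimes>) xs \<one> = g"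
      using cayley_awalk_word[OF p X] g by auto
    show ?thesis
    proof (rule ccontr)
      assume "\<not> 2 \<le> length p"
      then consider "xs = []" | x where "xs = [x]"
        using xs(2) by (cases xs; cases "tl xs") auto
      then show False
        using xs g X by cases auto
    qed
  qed
  then show ?thesis
    unfolding graph_dist_def \<mu>_def
    by (intro INF_greatest) (simp add: awalk_cost_def sum_list_triv)
qed

text \<open>The walk passes through \<open>u\<close>, \<open>u \<otimes> x\<close> and
  \<open>u \<otimes> (x \<otimes> y)\<close>. Admitting \<open>\<one>\<close> as a factor treats
  distances 0, 1 and 2 together: such a factor contributes the empty walk.\<close>

lemma (in group) cayley_graph_dist_le_two:
  assumes X: "X \<subseteq> carrier G" and u: "u \<in> carrier G"
    and xy: "x \<in> insert \<one> X" "y \<in> insert \<one> X"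
  shows "graph_dist (with_proj (cayley_graph G X)) u (u \<otimes> (x \<otimes> y)) \<le> 2"
proof -
  interpret wf_digraph "with_proj (cayley_graph G X)"
    by (rule wf_cayley_graph)
  have step: "\<exists>p. awalk v p (v \<otimes> z) \<and> length p \<le> 1"
    if "v \<in> carrier G" "z \<in> insert \<one> X" for v z
  proof (cases "z = \<one>")
    case True
    then show ?thesis
      using that by (intro exI[of _ "[]"]) (simp add: awalk_Nil_iff)
  next
    case False
    then have "z \<in> X" "z \<in> carrier G"
      using that X by auto
    then show ?thesis
      using that(1)
      by (intro exI[of _ "[(v, v \<otimes> z)]"])
        (auto simp: awalk_Cons_iff awalk_Nil_iff m_assoc[symmetric])
  qed
  have mem: "x \<in> carrier G" "y \<in> carrier G"
    using xy X by auto
  obtain p where p: "awalk u p (u \<otimes> x)" "length p \<le> 1"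
    using step[OF u xy(1)] by blast
  obtain q where q: "awalk (u \<otimes> x) q (u \<otimes> x \<otimes> y)" "length q \<le> 1"
    using step[of "u \<otimes> x" y] u mem xy by blast
  have "awalk u (p @ q) (u \<otimes> (x \<otimes> y))"
    using awalk_appendI[OF p(1) q(1)] u mem by (simp add: m_assoc)
  then have "\<mu> (\<lambda>_. 1) u (u \<otimes> (x \<otimes> y)) \<le> ereal (awalk_cost (\<lambda>_. 1) (p @ q))"
    by (rule min_cost_le_walk_cost)
  also have "\<dots> \<le> 2"
    using p(2) q(2) by (simp add: awalk_cost_def sum_list_triv)
  finally show ?thesis
    by (simp add: graph_dist_def)
qed

text \<open>The degree is \<open>card S - 1\<close> because \<open>S\<close> carries the identity
  and the connection set does not. The inequality \<open>less\<close> leaves an element outside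
  \<open>S\<close>, which keeps the diameter from dropping below two.\<close>

lemma (in group) order_in_cayley_orders_two:
  assumes fin: "finite (carrier G)" and S: "S \<subseteq> carrier G" "\<one> \<in> S"
    and inv: "\<And>x. x \<in> S \<Longrightarrow> inv x \<in> S"
    and cover: "carrier G \<subseteq> S <#> S" and less: "card S < order G"
  shows "order G \<in> cayley_orders (card S - 1) 2"
proof (rule cayley_ordersI)
  define X where "X = S - {\<one>}"
  have S_eq: "S = insert \<one> X" and X: "X \<subseteq> carrier G"
    using S by (auto simp: X_def)
  have prod: "\<exists>x\<in>S. \<exists>y\<in>S. g = x \<otimes> y" if "g \<in> carrier G" for g
    using subsetD[OF cover that] by (auto simp: set_mult_def)
  show "card (S - {\<one>}) = card S - 1"
    using S finite_subset[OF S(1) fin] by simp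
  show "cayley_set G (S - {\<one>})"
    unfolding cayley_set_def
  proof (intro conjI)
    \<comment> \<open>Every group element is a product of two elements of \<open>S\<close>, so the
      cover also yields generation.\<close>
    have "S \<subseteq> generate G X"
      by (auto simp: S_eq intro: generate.incl generate.one)
    then have "carrier G \<subseteq> generate G X"
      using prod generate.eng[of _ G X] by blast
    then show "generate G (S - {\<one>}) = carrier G"
      using generate_incl[OF X] by (simp add: X_def)
    show "set_inv (S - {\<one>}) = S - {\<one>}"
    proof
      show "set_inv (S - {\<one>}) \<subseteq> S - {\<one>}"
        using S inv by (auto simp: SET_INV_def subset_iff)
      show "S - {\<one>} \<subseteq> set_inv (S - {\<one>})"
      proof
        fix x assume "x \<in> S - {\<one>}"
        then have "x = inv (inv x)" "inv x \<in> S - {\<one>}"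
          using S inv by (auto simp: subset_iff)
        then show "x \<in> set_inv (S - {\<one>})"
          unfolding SET_INV_def by blast
      qed
    qed
  qed (use S in auto)
  show "graph_diameter (with_proj (cayley_graph G (S - {\<one>}))) = ereal (real 2)"
  proof (rule antisym)
    have "graph_dist (with_proj (cayley_graph G X)) u v \<le> 2"
      if uv: "u \<in> carrier G" "v \<in> carrier G" for u v
    proof -
      \<comment> \<open>A walk from \<open>u\<close> to \<open>v\<close> multiplies \<open>u\<close>
        on the right by \<open>inv u \<otimes> v\<close>, so it suffices to factor this element over
        \<open>S\<close>.\<close>
      obtain x y where xy: "x \<in> S" "y \<in> S" "inv u \<otimes> v = x \<otimes> y"
        using prod[of "inv u \<otimes> v"] uv by auto
      have "u \<otimes> (x \<otimes> y) = v"
        using uv by (simp add: xy(3)[symmetric] m_assoc[symmetric])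
      then show ?thesis
        using cayley_graph_dist_le_two[OF X uv(1), of x y] xy by (simp add: S_eq)
    qed
    then show "graph_diameter (with_proj (cayley_graph G (S - {\<one>}))) \<le> ereal (real 2)"
      unfolding graph_diameter_def X_def by (auto intro!: SUP_least)
    have "\<not> carrier G \<subseteq> S"
      using less card_mono[OF finite_subset[OF S(1) fin], of "carrier G"] by (auto simp: order_def)
    then obtain g where g: "g \<in> carrier G" "g \<noteq> \<one>" "g \<notin> X"
      by (auto simp: S_eq)
    have "2 \<le> graph_dist (with_proj (cayley_graph G X)) \<one> g"
      using X g by (rule cayley_graph_dist_one_ge_two)
    also have "\<dots> \<le> graph_diameter (with_proj (cayley_graph G X))"
      using g(1) by (intro graph_dist_le_diameter) simp_all
    finally show "ereal (real 2) \<le> graph_diameter (with_proj (cayley_graph G (S - {\<one>})))"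
      by (simp add: X_def)
  qed
qed (use fin in auto)


section \<open>The wreath product of a cyclic group with a group of order two\<close>

text \<open>The Boolean is the \<open>\<int>\<^sub>2\<close> component; when set in the left factor,
  it swaps the coordinates of the right factor before they are added. Over the integers, for
  \<open>n > 0\<close>, \<open>- a mod n\<close> is again a representative in
  \<open>{0..<n}\<close>.\<close>

definition wreath :: "int \<Rightarrow> (int \<times> int \<times> bool) monoid" where
  "wreath n =
     \<lparr> carrier = {0..<n} \<times> {0..<n} \<times> UNIV,
       monoid.mult = (\<lambda>(a, b, e) (c, d, f).
         ((a + (if e then d else c)) mod n, (b + (if e then c else d)) mod n, e \<noteq> f)),
       one = (0, 0, False) \<rparr>"

lemma wreath_sel [simp]:
  "(a, b, e) \<in> carrier (wreath n) \<longleftrightarrow> 0 \<le> a \<and> a < n \<and> 0 \<le> b \<and> b < n"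
  "(a, b, e) \<otimes>\<^bsub>wreath n\<^esub> (c, d, f) =
     ((a + (if e then d else c)) mod n, (b + (if e then c else d)) mod n, e \<noteq> f)"
  "\<one>\<^bsub>wreath n\<^esub> = (0, 0, False)"
  by (auto simp: wreath_def)

lemma finite_wreath: "finite (carrier (wreath n))"
  by (simp add: wreath_def)

lemma order_wreath: "order (wreath n) = 2 * nat n ^ 2"
  by (simp add: order_def wreath_def card_cartesian_product power2_eq_square)

lemma group_wreath:
  assumes "n > 0"
  shows "group (wreath n)"
proof (rule groupI)
  fix x assume "x \<in> carrier (wreath n)"
  obtain a b e where x: "x = (a, b, e)"
    by (cases x)
  show "\<exists>y\<in>carrier (wreath n). y \<otimes>\<^bsub>wreath n\<^esub> x = \<one>\<^bsub>wreath n\<^esub>"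
    using assms
    \<comment> \<open>If \<open>e\<close> holds, the left inverse swaps the coordinates of
      \<open>x\<close> during multiplication, so its own entries are negated in exchanged
      order.\<close>
    by (intro bexI[of _ "(- (if e then b else a) mod n, - (if e then a else b) mod n, e)"])
      (simp_all add: x mod_simps)
qed (use assms in \<open>auto simp: mod_simps add_ac split: if_splits\<close>)

lemma inv_wreath:
  assumes "n > 0" "(a, b, e) \<in> carrier (wreath n)"
  shows "inv\<^bsub>wreath n\<^esub> (a, b, e) =
    (if e then (- b mod n, - a mod n, e) else (- a mod n, - b mod n, e))"
proof (rule group.inv_equality[OF group_wreath[OF assms(1)]])
  show "(if e then (- b mod n, - a mod n, e) else (- a mod n, - b mod n, e))
      \<otimes>\<^bsub>wreath n\<^esub> (a, b, e) = \<one>\<^bsub>wreath n\<^esub>"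
    by (simp add: mod_simps)
qed (use assms in auto)


section \<open>A decidable covering criterion\<close>

text \<open>
  \<^term>\<open>diff_row n a ps qs\<close> lists the \<open>b\<close> with \<open>(a, b) \<in> qs - ps\<close>. The recursions avoid
  abstractions, whose bodies the simplifier would start to evaluate symbolically.
\<close>

primrec partners :: "int \<Rightarrow> int \<Rightarrow> int \<Rightarrow> (int \<times> int) list \<Rightarrow> int list" where
  "partners n k b [] = []"
| "partners n k b (q # qs) =
     (if fst q = k then (snd q - b) mod n # partners n k b qs else partners n k b qs)"

primrec diff_row :: "int \<Rightarrow> int \<Rightarrow> (int \<times> int) list \<Rightarrow> (int \<times> int) list \<Rightarrow> int list" where
  "diff_row n a [] qs = []"
| "diff_row n a (p # ps) qs = partners n ((a + fst p) mod n) (snd p) qs @ diff_row n a ps qs"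

primrec contains :: "'a list \<Rightarrow> 'a list \<Rightarrow> bool" where
  "contains ys [] \<longleftrightarrow> True"
| "contains ys (x # xs) \<longleftrightarrow> x \<in> set ys \<and> contains ys xs"

primrec even_rows :: "int \<Rightarrow> (int \<times> int) list \<Rightarrow> (int \<times> int) list \<Rightarrow> int list \<Rightarrow> bool" where
  "even_rows n ps qs [] \<longleftrightarrow> True"
| "even_rows n ps qs (a # as) \<longleftrightarrow>
     contains (diff_row n a qs qs @ diff_row n a ps ps) [0..n - 1] \<and> even_rows n ps qs as"

primrec odd_rows ::
  "int \<Rightarrow> (int \<times> int) list \<Rightarrow> (int \<times> int) list \<Rightarrow> (int \<times> int) list \<Rightarrow> int list \<Rightarrow> bool" where
  "odd_rows n ps ps' qs [] \<longleftrightarrow> True"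
| "odd_rows n ps ps' qs (a # as) \<longleftrightarrow>
     contains (diff_row n a ps qs @ diff_row n a ps' qs) [0..n - 1] \<and> odd_rows n ps ps' qs as"

text \<open>Distinctness turns list lengths into cardinalities, and \<open>(0, 0)\<close> in
  \<open>ps\<close> provides the identity. The two closure conditions mirror
  \<open>inv_wreath\<close>: with the flag set, inversion is
  \<open>(a, b) \<mapsto> (- b, - a)\<close> modulo \<open>n\<close>.\<close>

definition wreath_cover :: "int \<Rightarrow> (int \<times> int) list \<Rightarrow> (int \<times> int) list \<Rightarrow> bool" where
  "wreath_cover n ps qs \<longleftrightarrow>
     distinct ps \<and> distinct qs \<and> (0, 0) \<in> set ps \<and>
     list_all (\<lambda>(a, b). 0 \<le> a \<and> a < n \<and> 0 \<le> b \<and> b < n) (ps @ qs) \<and>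
     contains ps (map (\<lambda>(a, b). (- a mod n, - b mod n)) ps) \<and>
     contains qs (map (\<lambda>(a, b). (- b mod n, - a mod n)) qs) \<and>
     even_rows n ps qs [0..n - 1] \<and> odd_rows n ps (map prod.swap ps) qs [0..n - 1]"

lemma contains_iff: "contains ys xs \<longleftrightarrow> set xs \<subseteq> set ys"
  by (induction xs) auto

lemma even_rows_iff:
  "even_rows n ps qs as \<longleftrightarrow>
     (\<forall>a\<in>set as. {0..n - 1} \<subseteq> set (diff_row n a qs qs) \<union> set (diff_row n a ps ps))"
  by (induction as) (simp_all add: contains_iff)

lemma odd_rows_iff:
  "odd_rows n ps ps' qs as \<longleftrightarrow>
     (\<forall>a\<in>set as. {0..n - 1} \<subseteq> set (diff_row n a ps qs) \<union> set (diff_row n a ps' qs))"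
  by (induction as) (simp_all add: contains_iff)

lemma set_partners: "set (partners n k b qs) = {(d - b) mod n | d. (k, d) \<in> set qs}"
  by (induction qs) auto

lemma diff_rowE:
  assumes "y \<in> set (diff_row n a ps qs)"
  obtains i b d where "(i, b) \<in> set ps" "((a + i) mod n, d) \<in> set qs" "y = (d - b) mod n"
  using assms by (induction ps) (force simp: set_partners)+

section \<open>From a covering certificate to a lower bound\<close>

definition wreath_set :: "(int \<times> int) list \<Rightarrow> (int \<times> int) list \<Rightarrow> (int \<times> int \<times> bool) set" where
  "wreath_set ps qs =
     (\<lambda>(a, b). (a, b, False)) ` set ps \<union> (\<lambda>(a, b). (a, b, True)) ` set qs"

lemma wreath_set_iff [simp]:
  "(a, b, e) \<in> wreath_set ps qs \<longleftrightarrow> (a, b) \<in> set (if e then qs else ps)"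
  by (force simp: wreath_set_def)

lemma card_wreath_set:
  assumes "distinct ps" "distinct qs"
  shows "card (wreath_set ps qs) = length ps + length qs"
proof -
  have "card ((\<lambda>(a, b). (a, b, e)) ` set xs) = card (set xs)"
    for e :: bool and xs :: "(int \<times> int) list"
    by (intro card_image) (auto simp: inj_on_def)
  then show ?thesis
    using assms unfolding wreath_set_def
    by (subst card_Un_disjoint) (auto simp: distinct_card)
qed

lemma wreath_cover_bound:
  assumes cover: "wreath_cover n ps qs" and "n > 0"
    and len: "length ps + length qs = Suc d" and less: "Suc d < 2 * nat n ^ 2"
  shows "2 * nat n ^ 2 \<le> max_cayley_order d 2"
proof -
  interpret group "wreath n"
    using \<open>n > 0\<close> by (rule group_wreath)
  define S where "S = wreath_set ps qs"
  have range: "0 \<le> a \<and> a < n \<and> 0 \<le> b \<and> b < n" if "(a, b) \<in> set ps \<union> set qs" for a b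
    using cover that by (auto simp: wreath_cover_def list_all_iff)
  have sym: "(- a mod n, - b mod n) \<in> set ps" if "(a, b) \<in> set ps" for a b
    using cover that by (force simp: wreath_cover_def contains_iff)
  have sym': "(- b mod n, - a mod n) \<in> set qs" if "(a, b) \<in> set qs" for a b
    using cover that by (force simp: wreath_cover_def contains_iff)
  have S: "S \<subseteq> carrier (wreath n)"
    by (auto simp: S_def wreath_set_def dest!: range[OF UnI1] range[OF UnI2])
  have inv: "inv\<^bsub>wreath n\<^esub> x \<in> S" if "x \<in> S" for x
  proof (cases x)
    case (fields a b e)
    then have "inv\<^bsub>wreath n\<^esub> x =
        (if e then (- b mod n, - a mod n, e) else (- a mod n, - b mod n, e))"
      using subsetD[OF S that] \<open>n > 0\<close> by (metis inv_wreath)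
    then show ?thesis
      using that sym sym' by (cases e) (simp_all add: fields S_def)
  qed
  have "carrier (wreath n) \<subseteq> S <#>\<^bsub>wreath n\<^esub> S"
  proof
    fix g assume g: "g \<in> carrier (wreath n)"
    obtain a b e where g_eq: "g = (a, b, e)"
      by (cases g)
    with g have ab: "a \<in> {0..n - 1}" "b \<in> {0..n - 1}"
      by auto
    have ab_mod: "a mod n = a" "b mod n = b"
      using ab by auto
    have "\<exists>x\<in>S. \<exists>y\<in>S. g = x \<otimes>\<^bsub>wreath n\<^esub> y"
    proof (cases e)
      case False
      have "{0..n - 1} \<subseteq> set (diff_row n a qs qs) \<union> set (diff_row n a ps ps)"
        using cover ab(1) unfolding wreath_cover_def even_rows_iff by simp
      then consider "b \<in> set (diff_row n a qs qs)" | "b \<in> set (diff_row n a ps ps)"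
        using ab(2) by blast
      then show ?thesis
      proof cases
        case 1
        then obtain i c d where "(i, c) \<in> set qs" "((a + i) mod n, d) \<in> set qs" "b = (d - c) mod n"
          by (rule diff_rowE)
        \<comment> \<open>The right factor is the inverse of \<open>(i, c, True)\<close>; the swap
          by the left factor undoes its exchange of coordinates, leaving the plain
          difference.\<close>
        then show ?thesis
          using sym' ab_mod g_eq False unfolding S_def
          by (intro bexI[of _ "((a + i) mod n, d, True)"] bexI[of _ "(- c mod n, - i mod n, True)"])
            (simp_all add: mod_simps)
      next
        case 2
        then obtain i c d where "(i, c) \<in> set ps" "((a + i) mod n, d) \<in> set ps" "b = (d - c) mod n"
          by (rule diff_rowE)
        then show ?thesis
          using sym ab_mod g_eq False unfolding S_def
          by (intro bexI[of _ "((a + i) mod n, d, False)"] bexI[of _ "(- i mod n, - c mod n, False)"])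
            (simp_all add: mod_simps)
      qed
    next
      case True
      have "{0..n - 1} \<subseteq> set (diff_row n a ps qs) \<union> set (diff_row n a (map prod.swap ps) qs)"
        using cover ab(1) unfolding wreath_cover_def odd_rows_iff by simp
      then consider "b \<in> set (diff_row n a ps qs)" | "b \<in> set (diff_row n a (map prod.swap ps) qs)"
        using ab(2) by blast
      then show ?thesis
      proof cases
        case 1
        then obtain i c d where "(i, c) \<in> set ps" "((a + i) mod n, d) \<in> set qs" "b = (d - c) mod n"
          by (rule diff_rowE)
        \<comment> \<open>Here the inverse of \<open>(i, c, False)\<close> stands on the left, where
          it causes no swap.\<close>
        then show ?thesis
          using sym ab_mod g_eq True unfolding S_def
          by (intro bexI[of _ "(- i mod n, - c mod n, False)"] bexI[of _ "((a + i) mod n, d, True)"])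
            (simp_all add: mod_simps)
      next
        case 2
        then obtain i c d where "(i, c) \<in> set (map prod.swap ps)" "((a + i) mod n, d) \<in> set qs"
            "b = (d - c) mod n"
          by (rule diff_rowE)
        \<comment> \<open>With the element of \<open>P\<close> on the right, the flagged left factor
          swaps its coordinates; this is how the transpose of \<open>P\<close> enters.\<close>
        then show ?thesis
          using sym[of c i] ab_mod g_eq True unfolding S_def
          by (intro bexI[of _ "((a + i) mod n, d, True)"] bexI[of _ "(- c mod n, - i mod n, False)"])
            (auto simp: mod_simps)
      qed
    qed
    then show "g \<in> S <#>\<^bsub>wreath n\<^esub> S"
      by (auto simp: set_mult_def)
  qed
  moreover have "card S = Suc d"
    using cover len by (simp add: S_def card_wreath_set wreath_cover_def)
  moreover have "\<one>\<^bsub>wreath n\<^esub> \<in> S"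
    using cover by (simp add: S_def wreath_cover_def)
  ultimately have "2 * nat n ^ 2 \<in> cayley_orders d 2"
    using order_in_cayley_orders_two[OF finite_wreath S _ inv] less by (simp add: order_wreath)
  then show ?thesis
    unfolding max_cayley_order_def by (intro Max_ge finite_cayley_orders)
qed


section \<open>The connection sets\<close>

text \<open>For \<open>n\<close> = 10, 14, 18, 22 and 26 all nonzero points of the first list lie on
  the line \<open>a + b = n/2\<close> modulo \<open>n\<close>, which is closed under
  negation.\<close>

lemma wreath_cover_10:
  "wreath_cover 10
     [(0, 0), (3, 2), (4, 1), (5, 0), (6, 9), (7, 8)]
     [(1, 1), (1, 2), (1, 3), (2, 7), (3, 2), (3, 8), (7, 9), (8, 2), (8, 7), (8, 9),
      (9, 9)]"
  by code_simp

lemma wreath_cover_12: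
  "wreath_cover 12
     [(0, 0), (0, 6), (1, 5), (4, 2), (6, 6), (8, 10), (11, 7)]
     [(0, 0), (0, 4), (0, 6), (0, 7), (2, 1), (3, 7), (5, 0), (5, 9), (6, 0), (7, 5),
      (8, 0), (8, 3), (9, 3), (9, 4), (11, 10)]"
  by code_simp

lemma wreath_cover_14:
  "wreath_cover 14
     [(0, 0), (4, 3), (5, 2), (6, 1), (7, 0), (8, 13), (9, 12), (10, 11)]
     [(0, 2), (0, 9), (2, 2), (2, 5), (3, 10), (4, 11), (5, 0), (5, 1), (5, 9), (6, 5),
      (8, 6), (9, 8), (9, 12), (12, 0), (12, 12), (13, 9)]"
  by code_simp

lemma wreath_cover_16:
  "wreath_cover 16
     [(0, 0), (3, 1), (3, 9), (5, 15), (7, 5), (9, 11), (11, 1), (13, 7), (13, 15)]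
     [(0, 10), (0, 12), (2, 2), (2, 3), (4, 0), (5, 2), (5, 8), (6, 0), (7, 2), (8, 11),
      (11, 1), (11, 3), (11, 5), (12, 4), (13, 5), (13, 14), (14, 9), (14, 11), (14, 14),
      (15, 5)]"
  by code_simp

lemma wreath_cover_18:
  "wreath_cover 18
     [(0, 0), (1, 8), (2, 7), (3, 6), (5, 4), (9, 0), (13, 14), (15, 12), (16, 11),
      (17, 10)]
     [(0, 0), (0, 16), (0, 17), (1, 0), (1, 6), (2, 0), (2, 3), (2, 13), (3, 5), (5, 16),
      (6, 9), (7, 2), (7, 5), (9, 12), (11, 3), (12, 6), (12, 17), (13, 11), (13, 15),
      (15, 7), (15, 16), (16, 11)]"
  by code_simp

lemma wreath_cover_20:
  "wreath_cover 20
     [(0, 0), (0, 9), (0, 11), (1, 8), (3, 8), (4, 5), (4, 7), (16, 13), (16, 15),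
      (17, 12), (19, 12)]
     [(0, 13), (1, 8), (2, 3), (3, 3), (3, 8), (4, 6), (5, 6), (7, 0), (7, 7), (8, 12),
      (9, 8), (11, 7), (12, 11), (12, 17), (12, 19), (13, 9), (13, 13), (14, 2), (14, 5),
      (14, 15), (14, 16), (15, 2), (15, 6), (17, 17), (17, 18), (18, 5), (18, 6)]"
  by code_simp

lemma wreath_cover_22:
  "wreath_cover 22
     [(0, 0), (2, 9), (4, 7), (6, 5), (8, 3), (10, 1), (11, 0), (12, 21), (14, 19),
      (16, 17), (18, 15), (20, 13)]
     [(0, 0), (0, 4), (0, 11), (1, 21), (3, 19), (4, 2), (4, 13), (4, 16), (5, 17), (6, 7),
      (6, 18), (9, 13), (9, 18), (10, 2), (10, 4), (11, 0), (11, 4), (11, 11), (15, 7),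
      (15, 16), (18, 0), (18, 1), (18, 11), (18, 12), (20, 1), (20, 12), (20, 18), (21, 2),
      (21, 4)]"
  by code_simp

lemma wreath_cover_24:
  "wreath_cover 24
     [(0, 0), (0, 2), (0, 22), (4, 18), (4, 22), (8, 18), (10, 12), (10, 16), (14, 8),
      (14, 12), (16, 6), (20, 2), (20, 6)]
     [(1, 16), (2, 22), (3, 5), (5, 14), (6, 9), (6, 18), (7, 15), (8, 8), (8, 13),
      (8, 14), (8, 23), (9, 5), (9, 7), (9, 17), (10, 3), (10, 16), (10, 19), (11, 16),
      (12, 2), (13, 9), (15, 7), (15, 9), (15, 11), (15, 18), (16, 8), (16, 16), (17, 9),
      (17, 15), (19, 15), (19, 21), (21, 14), (22, 1), (22, 12), (23, 2)]"
  by code_simp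

lemma wreath_cover_26:
  "wreath_cover 26
     [(0, 0), (2, 11), (4, 9), (6, 7), (8, 5), (10, 3), (12, 1), (13, 0), (14, 25),
      (16, 23), (18, 21), (20, 19), (22, 17), (24, 15)]
     [(0, 8), (0, 20), (0, 24), (2, 0), (2, 3), (2, 7), (4, 9), (5, 20), (5, 21), (6, 0),
      (6, 9), (6, 21), (7, 3), (10, 3), (11, 1), (12, 1), (15, 8), (15, 11), (17, 5),
      (17, 9), (17, 20), (17, 22), (18, 0), (18, 1), (18, 11), (19, 7), (19, 24), (21, 9),
      (23, 3), (23, 16), (23, 19), (23, 24), (25, 1), (25, 8), (25, 14), (25, 15)]"
  by code_simp

lemma wreath_cover_28:
  "wreath_cover 28
     [(0, 0), (1, 6), (2, 5), (3, 18), (6, 15), (7, 14), (9, 26), (10, 11), (18, 17),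
      (19, 2), (21, 14), (22, 13), (25, 10), (26, 23), (27, 22)]
     [(0, 9), (0, 11), (0, 14), (0, 22), (2, 13), (4, 6), (4, 17), (4, 19), (4, 22),
      (6, 0), (6, 24), (8, 10), (8, 13), (9, 4), (9, 24), (11, 24), (12, 13), (14, 0),
      (14, 7), (14, 8), (14, 9), (15, 2), (15, 12), (15, 16), (15, 20), (15, 26), (16, 5),
      (16, 13), (17, 0), (18, 8), (18, 20), (19, 0), (19, 14), (20, 10), (20, 14),
      (21, 14), (22, 24), (23, 12), (24, 19), (26, 13)]"
  by code_simp

theorem theorem2:
  shows "max_cayley_order 16 2 \<ge> 200 \<and>
         max_cayley_order 21 2 \<ge> 288 \<and>
         max_cayley_order 23 2 \<ge> 392 \<and>
         max_cayley_order 28 2 \<ge> 512 \<and>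
         max_cayley_order 31 2 \<ge> 648 \<and>
         max_cayley_order 37 2 \<ge> 800 \<and>
         max_cayley_order 40 2 \<ge> 968 \<and>
         max_cayley_order 46 2 \<ge> 1152 \<and>
         max_cayley_order 49 2 \<ge> 1352 \<and>
         max_cayley_order 54 2 \<ge> 1568"
  \<comment> \<open>In each case the two lists have \<open>d + 1\<close> entries together, the extra
    one being the identity; \<open>simp\<close> counts them and evaluates
    \<open>2 * nat n ^ 2\<close>.\<close>
  using wreath_cover_bound[OF wreath_cover_10, of 16] wreath_cover_bound[OF wreath_cover_12, of 21]
    wreath_cover_bound[OF wreath_cover_14, of 23] wreath_cover_bound[OF wreath_cover_16, of 28]
    wreath_cover_bound[OF wreath_cover_18, of 31] wreath_cover_bound[OF wreath_cover_20, of 37]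
    wreath_cover_bound[OF wreath_cover_22, of 40] wreath_cover_bound[OF wreath_cover_24, of 46]
    wreath_cover_bound[OF wreath_cover_26, of 49] wreath_cover_bound[OF wreath_cover_28, of 54]
  by simp

end
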